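(* Let $X$ be a random network on a finite node set $\mathcal{N}$. Then $X$ is dissociated if and only if for every non-empty set of dyads $B\subseteq D(\mathcal{N})$ it holds that $$z_B=\prod_i z_{C_i},$$ where the $C_i$ are (the edge sets of) the connected components of $B$, viewed as a subgraph of the complete graph on $\mathcal{N}$.
   Context: $D(\mathcal{N})$ is the set of dyads (unordered pairs $ij$ of distinct nodes of $\mathcal{N}$). A random network on $\mathcal{N}$ is a family $X=(X_d)_{d\in D(\mathcal{N})}$ of $\{0,1\}$-valued random variables. $X$ is dissociated if, for every pair of disjoint subsets $\mathcal{N}',\mathcal{N}''\subseteq\mathcal{N}$, the families $(X_{ij})_{i,j\in\mathcal{N}'}$ and $(X_{kl})_{k,l\in\mathcal{N}''}$ are independent; equivalently, $X$ is Markov with respect to the bidirected incidence graph $L_{\leftrightarrow}(\mathcal{N})$ (vertex set $D(\mathcal{N})$, bidirected edges between distinct dyads sharing a node). A non-empty $B\subseteq D(\mathcal{N})$ is identified with the edge-induced subgraph of the complete graph on $\mathcal{N}$ with edge set $B$ (whose vertices are the endpoints of the edges in $B$). The Möbius parameters are $z_B=\mathbb{P}(X_d=1\text{ for all }d\in B)$. *)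

theory Defs
  imports "HOL-Probability.Probability"
begin

definition dyads :: "'a set \<Rightarrow> 'a set set" where
  "dyads N = {d. d \<subseteq> N \<and> card d = 2}"

text \<open>Values \<open>X d\<close> for sets \<open>d\<close> that are not dyads of \<open>N\<close> are unconstrained and irrelevant.\<close>

locale random_network = prob_space M
  for M :: "'w measure" and N :: "'a set" and X :: "'a set \<Rightarrow> 'w \<Rightarrow> nat" +
  assumes random_variable_dyad:
    "d \<in> dyads N \<Longrightarrow> random_variable (count_space {0, 1}) (X d)"
begin

text \<open>Each subfamily is treated as one random variable with values in the product
  space, so this is joint independence of the two families.\<close>

definition dissociated :: bool where
  "dissociated \<longleftrightarrow>
    (\<forall>N' N''. N' \<subseteq> N \<and> N'' \<subseteq> N \<and> N' \<inter> N'' = {} \<longrightarrow>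
      indep_var
        (\<Pi>\<^sub>M d\<in>dyads N'. count_space {0, 1}) (\<lambda>\<omega>. \<lambda>d\<in>dyads N'. X d \<omega>)
        (\<Pi>\<^sub>M d\<in>dyads N''. count_space {0, 1}) (\<lambda>\<omega>. \<lambda>d\<in>dyads N''. X d \<omega>))"

definition moebius :: "'a set set \<Rightarrow> real" where
  "moebius B = prob {\<omega> \<in> space M. \<forall>d\<in>B. X d \<omega> = 1}"

end

text \<open>Connectedness in the edge-induced subgraph, an equivalence relation on its
  vertex set \<open>\<Union>B\<close>.\<close>

definition connected_rel :: "'a set set \<Rightarrow> ('a \<times> 'a) set" where
  "connected_rel B = {(u, v). {u, v} \<in> B}\<^sup>* \<inter> (\<Union>B \<times> \<Union>B)"

text \<open>The edge sets of the connected components, one for each class of vertices.\<close>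

definition components_edges :: "'a set set \<Rightarrow> 'a set set set" where
  "components_edges B = (\<lambda>V. {e \<in> B. e \<subseteq> V}) ` (\<Union>B // connected_rel B)"

end

theory Submission
  imports Defs
begin

text \<open>
  Both sides of the equivalence amount to one multiplication rule:
  \<open>z (A \<union> B) = z A * z B\<close> whenever the dyad sets \<open>A\<close> and \<open>B\<close> share no node.

  On the probabilistic side, the events ``all dyads of \<open>B\<close> are present'', for \<open>B\<close> a set of
  dyads of \<open>N'\<close>, are closed under intersection, because intersecting them takes the union of the
  index sets.  Since the variables are binary, these events generate the whole sigma-algebra
  of the subnetwork on \<open>N'\<close>.  By the pi-lambda theorem, independence of two subnetworks needs to
  be checked on such events only, and there it is the multiplication rule
  (\<open>dissociated_iff_moebius_mult\<close>).

  On the combinatorial side, distinct components of \<open>B\<close> share no node, so that the multiplication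
  rule, applied to one component after another, gives the factorisation over components.
  Conversely, the components of a node-disjoint union \<open>A \<union> B\<close> are those of \<open>A\<close> together
  with those of \<open>B\<close> (\<open>components_edges_Un\<close>), so the factorisations of \<open>z A\<close> and \<open>z B\<close> multiply to
  that of \<open>z (A \<union> B)\<close>.
\<close>

section \<open>Connected components of a set of dyads\<close>

lemma finite_dyads: "finite N \<Longrightarrow> finite (dyads N)"
  unfolding dyads_def by (rule finite_subset[of _ "Pow N"]) auto

lemma dyads_mono: "N' \<subseteq> N \<Longrightarrow> dyads N' \<subseteq> dyads N"
  unfolding dyads_def by auto

lemma subset_dyads_iff: "B \<subseteq> dyads N \<Longrightarrow> B \<subseteq> dyads N' \<longleftrightarrow> \<Union>B \<subseteq> N'"
  unfolding dyads_def by blast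

lemma dyads_nonempty: "e \<in> dyads N \<Longrightarrow> e \<noteq> {}"
  unfolding dyads_def by auto

lemma equiv_connected_rel: "equiv (\<Union>B) (connected_rel B)"
proof (rule equivI)
  have "sym {(u, v). {u, v} \<in> B}"
    by (auto simp: sym_def insert_commute)
  then have "sym ({(u, v). {u, v} \<in> B}\<^sup>*)"
    by (rule sym_rtrancl)
  then show "sym (connected_rel B)"
    unfolding connected_rel_def sym_def by blast
  show "connected_rel B \<subseteq> \<Union>B \<times> \<Union>B" "refl_on (\<Union>B) (connected_rel B)"
    unfolding connected_rel_def refl_on_def by auto
  show "trans (connected_rel B)"
    unfolding connected_rel_def trans_def by (auto intro: rtrancl_trans)
qed

lemma connected_class_subset: "V \<in> \<Union>B // connected_rel B \<Longrightarrow> V \<subseteq> \<Union>B"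
  by (metis equiv_connected_rel in_quotient_imp_subset)

lemma Union_components_edges:
  assumes B: "B \<subseteq> dyads N"
  shows "\<Union>(components_edges B) = B"
proof
  show "\<Union>(components_edges B) \<subseteq> B"
    unfolding components_edges_def by auto
  show "B \<subseteq> \<Union>(components_edges B)"
  proof
    fix e assume e: "e \<in> B"
    then have "card e = 2" using B by (auto simp: dyads_def)
    then obtain u v where uv: "e = {u, v}" by (auto simp: card_2_iff)
    have "u \<in> \<Union>B" using e uv by auto
    moreover have "e \<subseteq> connected_rel B `` {u}"
      using e uv by (auto simp: connected_rel_def)
    ultimately show "e \<in> \<Union>(components_edges B)"
      using e unfolding components_edges_def by (blast intro: quotientI)
  qed
qed

lemma components_edges_nonempty:
  assumes B: "B \<subseteq> dyads N" and C: "C \<in> components_edges B"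
  shows "C \<noteq> {}"
proof -
  obtain x where x: "x \<in> \<Union>B" and Ceq: "C = {e \<in> B. e \<subseteq> connected_rel B `` {x}}"
    using C unfolding components_edges_def by (auto elim!: quotientE)
  obtain e where e: "e \<in> B" "x \<in> e" using x by auto
  then have "card e = 2" using B by (auto simp: dyads_def)
  then obtain v where "e = {x, v}" using e by (auto simp: card_2_iff)
  then have "e \<subseteq> connected_rel B `` {x}"
    using e by (auto simp: connected_rel_def)
  then show ?thesis using e Ceq by auto
qed

lemma components_edges_disjoint_nodes:
  assumes "C \<in> components_edges B" "D \<in> components_edges B" "C \<noteq> D"
  shows "\<Union>C \<inter> \<Union>D = {}"
proof -
  obtain V W where V: "V \<in> \<Union>B // connected_rel B" "C = {e \<in> B. e \<subseteq> V}"
    and W: "W \<in> \<Union>B // connected_rel B" "D = {e \<in> B. e \<subseteq> W}"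
    using assms unfolding components_edges_def by auto
  have "V \<inter> W = {}"
    using quotient_disj[OF equiv_connected_rel V(1) W(1)] V W assms(3) by auto
  then show ?thesis using V W by blast
qed

text \<open>A path that starts at a node of \<open>A\<close> can never use an edge of \<open>B\<close>, since the first such edge
  would have a node in common with \<open>A\<close>.\<close>

lemma connected_class_Un:
  assumes disj: "\<Union>A \<inter> \<Union>B = {}" and x: "x \<in> \<Union>A"
  shows "connected_rel (A \<union> B) `` {x} = connected_rel A `` {x}"
proof -
  have path: "(x, y) \<in> {(u, v). {u, v} \<in> A}\<^sup>* \<and> y \<in> \<Union>A"
    if "(x, y) \<in> {(u, v). {u, v} \<in> A \<union> B}\<^sup>*" for y
    using that
  proof (induction rule: rtrancl_induct)
    case base
    then show ?case using x by simp
  next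
    case (step y z)
    then have "{y, z} \<in> A" using disj by auto
    then show ?case using step.IH by (auto intro: rtrancl_into_rtrancl)
  qed
  have "{(u, v). {u, v} \<in> A}\<^sup>* \<subseteq> {(u, v). {u, v} \<in> A \<union> B}\<^sup>*"
    by (rule rtrancl_mono) auto
  then show ?thesis
    using path x unfolding connected_rel_def by blast
qed

text \<open>The classes of nodes of \<open>A\<close> contribute exactly the components of \<open>A\<close>: no edge of \<open>B\<close> fits
  into such a class, as every edge of \<open>B\<close> is non-empty and avoids the nodes of \<open>A\<close>.  By symmetry
  this is half of \<open>components_edges_Un\<close>.\<close>

lemma components_edges_Un_subset:
  assumes B: "B \<subseteq> dyads N" and disj: "\<Union>A \<inter> \<Union>B = {}"
  shows "(\<lambda>V. {e \<in> A \<union> B. e \<subseteq> V}) ` ((\<lambda>x. connected_rel (A \<union> B) `` {x}) ` \<Union>A)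
    = components_edges A"
proof -
  have eq: "{e \<in> A \<union> B. e \<subseteq> V} = {e \<in> A. e \<subseteq> V}" if "V \<in> \<Union>A // connected_rel A" for V
  proof -
    have "\<not> e \<subseteq> V" if "e \<in> B" for e
      using that connected_class_subset[OF \<open>V \<in> _\<close>] disj B dyads_nonempty[of e N] by blast
    then show ?thesis by auto
  qed
  have "(\<lambda>x. connected_rel (A \<union> B) `` {x}) ` \<Union>A = \<Union>A // connected_rel A"
    unfolding quotient_def using connected_class_Un[OF disj] by auto
  then show ?thesis
    unfolding components_edges_def using eq by (simp cong: image_cong)
qed

lemma components_edges_Un:
  assumes A: "A \<subseteq> dyads N" and B: "B \<subseteq> dyads N" and disj: "\<Union>A \<inter> \<Union>B = {}"
  shows "components_edges (A \<union> B) = components_edges A \<union> components_edges B"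
proof -
  have "components_edges (A \<union> B) =
      (\<lambda>V. {e \<in> A \<union> B. e \<subseteq> V}) ` ((\<lambda>x. connected_rel (A \<union> B) `` {x}) ` \<Union>A) \<union>
      (\<lambda>V. {e \<in> B \<union> A. e \<subseteq> V}) ` ((\<lambda>x. connected_rel (B \<union> A) `` {x}) ` \<Union>B)"
    unfolding components_edges_def quotient_def UNION_singleton_eq_range
    by (simp only: Union_Un_distrib image_Un Un_commute[of B A])
  also have "\<dots> = components_edges A \<union> components_edges B"
    using components_edges_Un_subset[OF B disj] components_edges_Un_subset[OF A, of B] disj
    by (simp add: Int_commute)
  finally show ?thesis .
qed

section \<open>Dissociation as a multiplication rule for the Moebius parameters\<close>

context random_network
begin

definition all_present :: "'a set set \<Rightarrow> 'w set" where
  "all_present B = {\<omega> \<in> space M. \<forall>d\<in>B. X d \<omega> = 1}"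

lemma moebius_eq: "moebius B = prob (all_present B)"
  by (simp add: moebius_def all_present_def)

lemma moebius_empty: "moebius {} = 1"
  by (simp add: moebius_def prob_space)

lemma all_present_Un: "all_present (A \<union> B) = all_present A \<inter> all_present B"
  by (auto simp: all_present_def)

lemma dyad_value: "d \<in> dyads N \<Longrightarrow> \<omega> \<in> space M \<Longrightarrow> X d \<omega> \<in> {0, 1}"
  using measurable_space[OF random_variable_dyad] by fastforce

lemma all_present_event:
  assumes "finite B" "B \<subseteq> dyads N"
  shows "all_present B \<in> events"
  using assms
proof (induction B)
  case empty
  show ?case by (simp add: all_present_def)
next
  case (insert d B)
  have "all_present {d} = X d -` {1} \<inter> space M"
    by (auto simp: all_present_def)
  also have "\<dots> \<in> events"
    using insert.prems by (intro measurable_sets[OF random_variable_dyad]) auto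
  finally show ?case
    using insert all_present_Un[of "{d}" B] by auto
qed

lemma subnetwork_measurable:
  assumes "I \<subseteq> dyads N"
  shows "random_variable (\<Pi>\<^sub>M d\<in>I. count_space {0, 1}) (\<lambda>\<omega>. \<lambda>d\<in>I. X d \<omega>)"
  using assms by (intro measurable_restrict random_variable_dyad) auto

text \<open>All preimages under the subnetwork on \<open>I\<close> are built from the events that a given dyad is present:
  the value of a binary variable is determined by whether it equals one.\<close>

lemma subnetwork_sigma_sets:
  assumes I: "I \<subseteq> dyads N"
  shows "sigma_sets (space M) {(\<lambda>\<omega>. \<lambda>d\<in>I. X d \<omega>) -` A \<inter> space M |A.
        A \<in> sets (\<Pi>\<^sub>M d\<in>I. count_space {0, 1})}
    \<subseteq> sigma_sets (space M) (all_present ` Pow I)"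
proof -
  let ?G = "sigma (space M) (all_present ` Pow I)"
  have sub: "all_present ` Pow I \<subseteq> Pow (space M)"
    by (auto simp: all_present_def)
  have coord: "X d \<in> measurable ?G (count_space {0, 1})" if d: "d \<in> I" for d
  proof (rule measurableI)
    show "X d \<omega> \<in> space (count_space {0, 1})" if "\<omega> \<in> space ?G" for \<omega>
      using that dyad_value I d sub by (auto simp: space_measure_of)
  next
    fix S :: "nat set" assume "S \<in> sets (count_space {0, 1})"
    then have "S \<in> Pow {0, 1}" by simp
    then have "S \<in> {{}, {0}, {1}, {0, 1}}" by auto
    moreover have one: "all_present {d} \<in> sets ?G"
      using d sub by (auto simp: sets_measure_of intro!: sigma_sets.Basic)
    moreover have "X d -` {1} \<inter> space ?G = all_present {d}"
      using sub by (auto simp: space_measure_of all_present_def)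
    moreover have "X d -` {0} \<inter> space ?G = space ?G - all_present {d}"
      using sub dyad_value[of d] I d by (fastforce simp: space_measure_of all_present_def)
    moreover have "X d -` {0, 1} \<inter> space ?G = space ?G"
      using sub dyad_value[of d] I d by (fastforce simp: space_measure_of)
    ultimately show "X d -` S \<inter> space ?G \<in> sets ?G"
      using sets.compl_sets[OF one] by auto
  qed
  have "(\<lambda>\<omega>. \<lambda>d\<in>I. X d \<omega>) \<in> measurable ?G (\<Pi>\<^sub>M d\<in>I. count_space {0, 1})"
    by (intro measurable_restrict coord)
  then have "(\<lambda>\<omega>. \<lambda>d\<in>I. X d \<omega>) -` A \<inter> space M \<in> sigma_sets (space M) (all_present ` Pow I)"
    if "A \<in> sets (\<Pi>\<^sub>M d\<in>I. count_space {0, 1})" for A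
    using measurable_sets[of _ ?G, OF _ that] sub by (simp add: space_measure_of sets_measure_of)
  then show ?thesis
    by (intro sigma_sets_mono) auto
qed

text \<open>The pi-lambda theorem reduces independence to the intersection-stable generator.\<close>

lemma indep_var_subnetworksI:
  assumes I: "finite I" "I \<subseteq> dyads N" and J: "finite J" "J \<subseteq> dyads N"
    and mult: "\<And>A B. A \<subseteq> I \<Longrightarrow> B \<subseteq> J \<Longrightarrow> moebius (A \<union> B) = moebius A * moebius B"
  shows "indep_var
    (\<Pi>\<^sub>M d\<in>I. count_space {0, 1}) (\<lambda>\<omega>. \<lambda>d\<in>I. X d \<omega>)
    (\<Pi>\<^sub>M d\<in>J. count_space {0, 1}) (\<lambda>\<omega>. \<lambda>d\<in>J. X d \<omega>)"
proof -
  have ev: "all_present ` Pow K \<subseteq> events" if "finite K" "K \<subseteq> dyads N" for K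
    using that by (auto intro!: all_present_event intro: finite_subset)
  have stable: "Int_stable (all_present ` Pow K)" for K
    unfolding Int_stable_def by (auto simp flip: all_present_Un)
  have "indep_set (all_present ` Pow I) (all_present ` Pow J)"
    using mult by (intro indep_setI ev I J) (auto simp: moebius_eq all_present_Un)
  then have "indep_set (sigma_sets (space M) (all_present ` Pow I))
      (sigma_sets (space M) (all_present ` Pow J))"
    by (intro indep_set_sigma_sets stable)
  then show ?thesis
    unfolding indep_var_eq indep_set_def
    using subnetwork_sigma_sets[OF I(2)] subnetwork_sigma_sets[OF J(2)]
      subnetwork_measurable[OF I(2)] subnetwork_measurable[OF J(2)]
    by (intro conjI; (elim indep_sets_mono_sets)?) (simp_all split: bool.split)
qed

lemma indep_var_subnetworksD:
  assumes I: "finite I" "I \<subseteq> dyads N" and J: "finite J" "J \<subseteq> dyads N"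
    and indep: "indep_var
      (\<Pi>\<^sub>M d\<in>I. count_space {0, 1}) (\<lambda>\<omega>. \<lambda>d\<in>I. X d \<omega>)
      (\<Pi>\<^sub>M d\<in>J. count_space {0, 1}) (\<lambda>\<omega>. \<lambda>d\<in>J. X d \<omega>)"
    and A: "A \<subseteq> I" and B: "B \<subseteq> J"
  shows "moebius (A \<union> B) = moebius A * moebius B"
proof -
  define cyl where "cyl K S = (\<Pi>\<^sub>E d\<in>K. if d \<in> S then {1} else {0, 1 :: nat})"
    for K S :: "'a set set"
  have cyl_sets: "cyl K S \<in> sets (\<Pi>\<^sub>M d\<in>K. count_space {0, 1})" if "finite K" for K S
    unfolding cyl_def using that by (intro sets_PiM_I_finite) auto
  have cyl_iff: "(\<lambda>d\<in>K. X d \<omega>) \<in> cyl K S \<longleftrightarrow> \<omega> \<in> all_present S"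
    if "K \<subseteq> dyads N" "S \<subseteq> K" "\<omega> \<in> space M" for K S \<omega>
    using that dyad_value[OF _ that(3)]
    by (fastforce simp: cyl_def all_present_def PiE_iff)
  have pre: "(\<lambda>\<omega>. \<lambda>d\<in>K. X d \<omega>) -` cyl K S \<inter> space M = all_present S"
    if "K \<subseteq> dyads N" "S \<subseteq> K" for K S
    using cyl_iff[OF that] by (auto simp: all_present_def)
  have "(\<lambda>\<omega>. (\<lambda>d\<in>I. X d \<omega>, \<lambda>d\<in>J. X d \<omega>)) -` (cyl I A \<times> cyl J B) \<inter> space M
      = all_present (A \<union> B)"
    using pre[OF I(2) A] pre[OF J(2) B] all_present_Un[of A B] by blast
  then show ?thesis
    using indep_varD[OF indep cyl_sets[OF I(1), of A] cyl_sets[OF J(1), of B]]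
      pre[OF I(2) A] pre[OF J(2) B]
    by (simp add: moebius_eq)
qed

lemma dissociated_iff_moebius_mult:
  assumes N: "finite N"
  shows "dissociated \<longleftrightarrow>
    (\<forall>A B. A \<subseteq> dyads N \<and> B \<subseteq> dyads N \<and> \<Union>A \<inter> \<Union>B = {} \<longrightarrow>
      moebius (A \<union> B) = moebius A * moebius B)"
    (is "_ \<longleftrightarrow> ?mult")
proof
  assume diss: dissociated
  show ?mult
  proof (intro allI impI, elim conjE)
    fix A B assume A: "A \<subseteq> dyads N" and B: "B \<subseteq> dyads N" and disj: "\<Union>A \<inter> \<Union>B = {}"
    have sub: "\<Union>A \<subseteq> N" "\<Union>B \<subseteq> N"
      using A B by (auto simp: dyads_def)
    have "A \<subseteq> dyads (\<Union>A)" "B \<subseteq> dyads (\<Union>B)"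
      using subset_dyads_iff[OF A] subset_dyads_iff[OF B] by auto
    then show "moebius (A \<union> B) = moebius A * moebius B"
      using diss sub disj N unfolding dissociated_def
      by (intro indep_var_subnetworksD[of "dyads (\<Union>A)" "dyads (\<Union>B)"])
        (auto intro: finite_dyads finite_subset dest: dyads_mono)
  qed
next
  assume mult: ?mult
  show dissociated
    unfolding dissociated_def
  proof (intro allI impI, elim conjE)
    fix N' N'' assume sub: "N' \<subseteq> N" "N'' \<subseteq> N" and disj: "N' \<inter> N'' = {}"
    have dy: "dyads N' \<subseteq> dyads N" "dyads N'' \<subseteq> dyads N"
      using sub by (auto dest: dyads_mono)
    have fin: "finite (dyads N')" "finite (dyads N'')"
      using sub N by (auto intro: finite_dyads finite_subset)
    show "indep_var
        (\<Pi>\<^sub>M d\<in>dyads N'. count_space {0, 1}) (\<lambda>\<omega>. \<lambda>d\<in>dyads N'. X d \<omega>)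
        (\<Pi>\<^sub>M d\<in>dyads N''. count_space {0, 1}) (\<lambda>\<omega>. \<lambda>d\<in>dyads N''. X d \<omega>)"
    proof (rule indep_var_subnetworksI[OF fin(1) dy(1) fin(2) dy(2)])
      fix A B assume AB: "A \<subseteq> dyads N'" "B \<subseteq> dyads N''"
      then have "\<Union>A \<subseteq> N'" "\<Union>B \<subseteq> N''" by (auto simp: dyads_def)
      then have "\<Union>A \<inter> \<Union>B = {}" using disj by blast
      moreover have "A \<subseteq> dyads N" "B \<subseteq> dyads N" using AB dy by auto
      ultimately show "moebius (A \<union> B) = moebius A * moebius B"
        using mult by simp
    qed
  qed
qed

section \<open>Factorisation over components\<close>

lemma moebius_Union_components:
  assumes mult: "\<And>A B. A \<subseteq> dyads N \<Longrightarrow> B \<subseteq> dyads N \<Longrightarrow> \<Union>A \<inter> \<Union>B = {} \<Longrightarrow>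
      moebius (A \<union> B) = moebius A * moebius B"
    and B: "B \<subseteq> dyads N" and S: "finite S" "S \<subseteq> components_edges B"
  shows "moebius (\<Union>S) = (\<Prod>C\<in>S. moebius C)"
  using S
proof (induction S)
  case empty
  show ?case by (simp add: moebius_empty)
next
  case (insert C S)
  have "\<Union>(insert C S) \<subseteq> dyads N"
    using insert.prems Union_components_edges[OF B] B by blast
  moreover have "\<Union>C \<inter> \<Union>D = {}" if "D \<in> S" for D
    using that insert by (intro components_edges_disjoint_nodes[of _ B]) auto
  then have "\<Union>C \<inter> \<Union>(\<Union>S) = {}" by blast
  ultimately have "moebius (C \<union> \<Union>S) = moebius C * moebius (\<Union>S)"
    by (intro mult) auto
  then show ?case using insert by simp
qed

lemma moebius_mult_of_factorisation:
  assumes N: "finite N"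
    and fact: "\<And>B. B \<subseteq> dyads N \<Longrightarrow> B \<noteq> {} \<Longrightarrow> moebius B = (\<Prod>C\<in>components_edges B. moebius C)"
    and A: "A \<subseteq> dyads N" and B: "B \<subseteq> dyads N" and disj: "\<Union>A \<inter> \<Union>B = {}"
  shows "moebius (A \<union> B) = moebius A * moebius B"
proof -
  have fact': "moebius E = (\<Prod>C\<in>components_edges E. moebius C)" if "E \<subseteq> dyads N" for E
    using fact[OF that] by (cases "E = {}") (auto simp: moebius_empty components_edges_def)
  have fin: "finite (components_edges E)" if "E \<subseteq> dyads N" for E
    using that N finite_subset[OF that finite_dyads] Union_components_edges[OF that]
    by (metis finite_UnionD)
  \<comment> \<open>A common component would contain an edge, whose endpoints would be nodes of both sets.\<close>
  have "components_edges A \<inter> components_edges B = {}"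
  proof (rule ccontr)
    assume "components_edges A \<inter> components_edges B \<noteq> {}"
    then obtain C where C: "C \<in> components_edges A" "C \<in> components_edges B" by blast
    obtain e where "e \<in> C" using components_edges_nonempty[OF A C(1)] by blast
    then have "e \<in> A" "e \<in> B"
      using C Union_components_edges[OF A] Union_components_edges[OF B] by blast+
    then show False using disj A dyads_nonempty[of e N] by blast
  qed
  then show ?thesis
    using A B fin fact' by (simp add: components_edges_Un[OF A B disj] prod.union_disjoint)
qed

end

theorem lemma1:
  fixes M :: "'w measure" and N :: "'a set" and X :: "'a set \<Rightarrow> 'w \<Rightarrow> nat"
  assumes "finite N"
    and "random_network M N X"
  shows "random_network.dissociated M N X \<longleftrightarrow>
    (\<forall>B. B \<subseteq> dyads N \<and> B \<noteq> {} \<longrightarrow>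
      random_network.moebius M X B =
        (\<Prod>C\<in>components_edges B. random_network.moebius M X C))"
proof -
  interpret random_network M N X by fact
  show ?thesis
  proof
    assume "dissociated"
    then have mult: "\<And>A B. A \<subseteq> dyads N \<Longrightarrow> B \<subseteq> dyads N \<Longrightarrow> \<Union>A \<inter> \<Union>B = {} \<Longrightarrow>
        moebius (A \<union> B) = moebius A * moebius B"
      using dissociated_iff_moebius_mult[OF assms(1)] by blast
    show "\<forall>B. B \<subseteq> dyads N \<and> B \<noteq> {} \<longrightarrow> moebius B = (\<Prod>C\<in>components_edges B. moebius C)"
    proof (intro allI impI, elim conjE)
      fix B assume B: "B \<subseteq> dyads N"
      have "finite (components_edges B)"
        using finite_subset[OF B finite_dyads[OF assms(1)]] Union_components_edges[OF B]
        by (metis finite_UnionD)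
      then have "moebius (\<Union>(components_edges B)) = (\<Prod>C\<in>components_edges B. moebius C)"
        using mult B by (intro moebius_Union_components[of B]) auto
      then show "moebius B = (\<Prod>C\<in>components_edges B. moebius C)"
        by (simp only: Union_components_edges[OF B])
    qed
  next
    assume fact: "\<forall>B. B \<subseteq> dyads N \<and> B \<noteq> {} \<longrightarrow> moebius B = (\<Prod>C\<in>components_edges B. moebius C)"
    show "dissociated"
      unfolding dissociated_iff_moebius_mult[OF assms(1)]
    proof (intro allI impI, elim conjE)
      fix A B assume "A \<subseteq> dyads N" "B \<subseteq> dyads N" "\<Union>A \<inter> \<Union>B = {}"
      then show "moebius (A \<union> B) = moebius A * moebius B"
        using fact by (intro moebius_mult_of_factorisation[OF assms(1)]) blast+
    qed
  qed
qed

end
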